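(* Let $S$ be a (finite) connected $\mathscr R$-trivial semigroup and let $\{e_X\mid X\in\Lambda(S)\}$ be a fixed family of pairwise orthogonal idempotents of $\mathbb ZS$ with $\tau(e_X)=\delta_X$ for all $X$ and $\sum_{X\in\Lambda(S)}e_X=1$. If $s\in S$, then $se_{d(s)}=s+\sum_{t<_{\mathscr R}s}n_tt$ for some integers $n_t$. Hence the elements of the form $se_{d(s)}$ with $s\in S$ form a basis for $\mathbb ZS$.
   Context: All semigroups are finite. $S^1$ denotes $S$ with an adjoined identity. Write $s\leq_{\mathscr R}t$ iff $sS^1\subseteq tS^1$; $S$ is $\mathscr R$-trivial if $\leq_{\mathscr R}$ is a partial order. For $s\in S$, $s^\omega$ denotes the unique idempotent power of $s$. For $S$ $\mathscr R$-trivial, $\Lambda(S)$ is the set of left ideals of the form $Se$ with $e\in S$ idempotent, ordered by inclusion; it is closed under intersection, hence is a meet semilattice, and $c\colon S\to\Lambda(S)$, $c(s)=Ss^\omega$, is a surjective homomorphism. An $\mathscr R$-trivial semigroup $S$ is connected if $s\in sS$ for all $s\in S$ and the equivalence relation $\{(s,t): c(s)=c(t)\}$ is the equivalence relation generated by all pairs $(s,t)$ such that $c(s)=c(t)$ and there is $x\in S$ with $xs=s$ and $xt=t$. If $S$ is connected, then $\mathbb ZS$ has an identity, and each $s\in S$ belongs to a unique least element of $\Lambda(S)$, denoted $d(s)$. $\tau\colon\mathbb ZS\to\mathbb Z^{\Lambda(S)}$ is the surjective ring homomorphism sending $s\in S$ to the characteristic function of $\{Z\in\Lambda(S): Z\leq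 c(s)\}$; $\delta_X$ is the characteristic function of $\{X\}$. The kernel of $\tau$ is nilpotent, so a family $\{e_X\}$ as in the statement exists. *)

theory Defs
  imports Main "HOL-Library.Indicator_Function"
begin

text \<open>A finite semigroup \<open>S\<close> is the universe of a type of sort
  \<open>{finite, semigroup_mult}\<close>.\<close>

subsection \<open>Semigroups\<close>

text \<open>\<open>s S\<^sup>1 \<subseteq> t S\<^sup>1\<close>, where \<open>s S\<^sup>1 = {s} \<union> s S\<close>.\<close>

definition R_le :: "'a::semigroup_mult \<Rightarrow> 'a \<Rightarrow> bool" (infix \<open>\<le>\<^sub>R\<close> 50)
  where "s \<le>\<^sub>R t \<longleftrightarrow> insert s (range (\<lambda>x. s * x)) \<subseteq> insert t (range (\<lambda>x. t * x))"

definition R_less :: "'a::semigroup_mult \<Rightarrow> 'a \<Rightarrow> bool" (infix \<open><\<^sub>R\<close> 50)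
  where "s <\<^sub>R t \<longleftrightarrow> s \<le>\<^sub>R t \<and> s \<noteq> t"

definition R_trivial :: "'a::semigroup_mult itself \<Rightarrow> bool"
  where "R_trivial _ \<longleftrightarrow> partial_order_on UNIV {(s::'a, t). s \<le>\<^sub>R t}"

text \<open>The positive powers of \<open>s\<close> are \<open>((\<lambda>x. s * x) ^^ n) s = s\<^bsup>n+1\<^esup>\<close>.\<close>

definition omega_power :: "'a::{finite, semigroup_mult} \<Rightarrow> 'a" (\<open>_\<^sup>\<omega>\<close> [1000] 999)
  where "s\<^sup>\<omega> = (THE x. x * x = x \<and> (\<exists>n. x = ((\<lambda>y. s * y) ^^ n) s))"

definition Lambda :: "'a::semigroup_mult set set"
  where "Lambda = {range (\<lambda>x. x * e) | e. e * e = e}"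

definition c_ideal :: "'a::{finite, semigroup_mult} \<Rightarrow> 'a set"
  where "c_ideal s = range (\<lambda>x. x * s\<^sup>\<omega>)"

definition d_ideal :: "'a::semigroup_mult \<Rightarrow> 'a set"
  where "d_ideal s = (LEAST X. X \<in> Lambda \<and> s \<in> X)"

definition connected_semigroup :: "'a::{finite, semigroup_mult} itself \<Rightarrow> bool"
  where "connected_semigroup _ \<longleftrightarrow>
    (\<forall>s::'a. s \<in> range (\<lambda>x. s * x)) \<and>
    (\<lambda>s t::'a. c_ideal s = c_ideal t) = equivclp (\<lambda>s t. c_ideal s = c_ideal t \<and> (\<exists>x. x * s = s \<and> x * t = t))"

subsection \<open>The integral semigroup ring\<close>

typedef 'a semigroup_ring = "UNIV :: ('a \<Rightarrow> int) set"
  morphisms coeff of_coeff ..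

setup_lifting type_definition_semigroup_ring

instantiation semigroup_ring :: (type) ab_group_add
begin

lift_definition zero_semigroup_ring :: "'a semigroup_ring" is "\<lambda>_. 0" .
lift_definition plus_semigroup_ring ::
  "'a semigroup_ring \<Rightarrow> 'a semigroup_ring \<Rightarrow> 'a semigroup_ring" is "\<lambda>f g s. f s + g s" .
lift_definition uminus_semigroup_ring ::
  "'a semigroup_ring \<Rightarrow> 'a semigroup_ring" is "\<lambda>f s. - f s" .
lift_definition minus_semigroup_ring ::
  "'a semigroup_ring \<Rightarrow> 'a semigroup_ring \<Rightarrow> 'a semigroup_ring" is "\<lambda>f g s. f s - g s" .

instance
  by standard (transfer, simp add: fun_eq_iff algebra_simps)+

end

instantiation semigroup_ring :: ("{finite, semigroup_mult}") ring
begin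

lift_definition times_semigroup_ring ::
  "'a semigroup_ring \<Rightarrow> 'a semigroup_ring \<Rightarrow> 'a semigroup_ring"
  is "\<lambda>f g u. \<Sum>(s, t) | s * t = u. f s * g t" .

instance
proof
  fix a b c :: "'a semigroup_ring"
  show "a * b * c = a * (b * c)"
  proof (transfer, rule ext)
    fix f g h :: "'a \<Rightarrow> int" and u :: 'a
    have "(\<Sum>(p, t) | p * t = u. (\<Sum>(r, s) | r * s = p. f r * g s) * h t) =
        (\<Sum>(x, y) \<in> (SIGMA x:{(p, t). p * t = u}. {(r, s). r * s = fst x}).
          f (fst y) * g (snd y) * h (snd x))"
      by (subst sum.Sigma [symmetric]) (auto simp: sum_distrib_right split_def)
    also have "\<dots> = (\<Sum>(x, y) \<in> (SIGMA x:{(r, q). r * q = u}. {(s, t). s * t = snd x}).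
          f (fst x) * g (fst y) * h (snd y))"
      by (rule sum.reindex_bij_witness
          [where i = "\<lambda>((r, q), (s, t)). ((r * s, t), (r, s))"
             and j = "\<lambda>((p, t), (r, s)). ((r, s * t), (s, t))"])
        (auto simp: mult.assoc)
    also have "\<dots> = (\<Sum>(r, q) | r * q = u. f r * (\<Sum>(s, t) | s * t = q. g s * h t))"
      by (subst sum.Sigma [symmetric]) (auto simp: sum_distrib_left split_def mult.assoc)
    finally show "(\<Sum>(p, t) | p * t = u. (\<Sum>(r, s) | r * s = p. f r * g s) * h t) =
        (\<Sum>(r, q) | r * q = u. f r * (\<Sum>(s, t) | s * t = q. g s * h t))" .
  qed
  show "(a + b) * c = a * c + b * c"
    by transfer (simp add: fun_eq_iff split_def distrib_right sum.distrib)
  show "a * (b + c) = a * b + a * c"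
    by transfer (simp add: fun_eq_iff split_def distrib_left sum.distrib)
qed

end

lift_definition scale :: "int \<Rightarrow> 'a semigroup_ring \<Rightarrow> 'a semigroup_ring" is "\<lambda>n f s. n * f s" .

interpretation ZS: module "scale :: int \<Rightarrow> 'a semigroup_ring \<Rightarrow> 'a semigroup_ring"
  by standard (transfer, simp add: fun_eq_iff algebra_simps)+

lift_definition elt :: "'a \<Rightarrow> 'a semigroup_ring" is "\<lambda>s t. if t = s then 1 else 0" .

lemma elt_mult: "elt s * elt t = elt (s * t)"
  for s t :: "'a::{finite, semigroup_mult}"
proof (transfer, rule ext)
  fix s t u :: 'a
  have "(\<Sum>(x, y) | x * y = u. (if x = s then 1 else 0) * (if y = t then 1 else 0)) =
      (\<Sum>p \<in> {(x, y). x * y = u}. if p = (s, t) then 1 else (0::int))"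
    by (rule sum.cong) (auto split: if_splits)
  then show "(\<Sum>(x, y) | x * y = u. (if x = s then 1 else 0) * (if y = t then 1 else 0)) =
      (if u = s * t then 1 else (0::int))"
    by (auto simp: sum.delta)
qed

text \<open>The type class gives no unit, since \<open>\<int>S\<close> need not have one.\<close>

definition is_identity :: "'a::{finite, semigroup_mult} semigroup_ring \<Rightarrow> bool"
  where "is_identity u \<longleftrightarrow> (\<forall>a. u * a = a \<and> a * u = a)"

text \<open>Indexed by \<open>'i\<close>, so a basis has no repeated members.\<close>

definition is_basis :: "('i \<Rightarrow> 'a semigroup_ring) \<Rightarrow> bool"
  where "is_basis b \<longleftrightarrow> inj b \<and> ZS.independent (range b) \<and> ZS.span (range b) = UNIV"

subsection \<open>The homomorphism to \<open>\<int>\<^sup>\<Lambda>\<close>\<close>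

text \<open>Elements of \<open>\<int>\<^sup>\<Lambda>\<close> are represented as functions on all subsets of \<open>S\<close> that vanish outside
  \<open>Lambda\<close>.  \<open>tau\<close> is the linear extension of its values on \<open>S\<close>.\<close>

definition tau :: "'a::{finite, semigroup_mult} semigroup_ring \<Rightarrow> 'a set \<Rightarrow> int"
  where "tau a Z = (\<Sum>s\<in>UNIV. coeff a s * indicator {Y \<in> Lambda. Y \<subseteq> c_ideal s} Z)"

definition delta :: "'a set \<Rightarrow> 'a set \<Rightarrow> int"
  where "delta X = indicator {X}"

end

theory Submission
  imports Defs
begin

text \<open>In an \<open>\<R>\<close>-trivial semigroup the right stabilizer \<open>{t. s t = s}\<close> is closed under taking
  factors, because \<open>s t\<^sub>1 t\<^sub>2 = s\<close> gives \<open>s \<le> s t\<^sub>1 \<le> s\<close>.  So \<open>s t = s\<close> is equivalent to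
  \<open>s t\<^sup>\<omega> = s\<close>, that is to \<open>s \<in> c(t)\<close>, that is to \<open>d(s) \<subseteq> c(t)\<close>.  The coefficient
  of \<open>s\<close> in \<open>s e\<^sub>X\<close> with \<open>X = d(s)\<close> is therefore \<open>\<tau>(e\<^sub>X)(X) = 1\<close>, and all other elements
  \<open>s t\<close> of its support lie strictly \<open>\<R>\<close>-below \<open>s\<close>.  Unitriangularity gives the basis.\<close>

section \<open>Order, right stabilizers and idempotent powers\<close>

lemma R_le_iff: "s \<le>\<^sub>R t \<longleftrightarrow> s = t \<or> (\<exists>x. s = t * x)"
  by (auto simp: R_le_def mult.assoc)

lemma R_le_mult: "s * t \<le>\<^sub>R s"
  by (auto simp: R_le_iff)

lemma R_le_trans: "s \<le>\<^sub>R t \<Longrightarrow> t \<le>\<^sub>R u \<Longrightarrow> s \<le>\<^sub>R u"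
  by (auto simp: R_le_def)

lemma R_trivial_antisym:
  assumes "R_trivial TYPE('a::semigroup_mult)" "(s::'a) \<le>\<^sub>R t" "t \<le>\<^sub>R s"
  shows "s = t"
  using assms by (auto simp: R_trivial_def partial_order_on_def antisym_def)

lemma R_trivial_stabilizer_mult:
  assumes "R_trivial TYPE('a::semigroup_mult)"
  shows "(s::'a) * (t * u) = s \<longleftrightarrow> s * t = s \<and> s * u = s"
proof
  assume *: "s * (t * u) = s"
  then have "s \<le>\<^sub>R s * t"
    by (metis R_le_mult mult.assoc)
  then have "s * t = s"
    using R_trivial_antisym[OF assms] R_le_mult by blast
  with * show "s * t = s \<and> s * u = s"
    by (metis mult.assoc)
qed (metis mult.assoc)

text \<open>\<open>((*) s ^^ n) s\<close> is \<open>s\<^bsup>n+1\<^esup>\<close>, as in the definition of \<open>omega_power\<close>.\<close>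

lemma funpow_mult_add:
  fixes s :: "'a::semigroup_mult"
  shows "((*) s ^^ m) s * ((*) s ^^ n) s = ((*) s ^^ Suc (m + n)) s"
  by (induction m) (simp_all add: mult.assoc)

lemma R_trivial_stabilizer_power:
  assumes "R_trivial TYPE('a::semigroup_mult)"
  shows "(x::'a) * ((*) s ^^ n) s = x \<longleftrightarrow> x * s = x"
  by (induction n) (simp_all add: R_trivial_stabilizer_mult[OF assms])

lemma R_trivial_ex_idempotent_power:
  assumes "R_trivial TYPE('a::{finite, semigroup_mult})"
  shows "\<exists>n. ((*) s ^^ n) (s::'a) * ((*) s ^^ n) s = ((*) s ^^ n) s"
proof -
  have "\<not> inj (\<lambda>n. ((*) s ^^ n) s)"
    using finite_imageD[of "\<lambda>n. ((*) s ^^ n) s" UNIV] infinite_UNIV_nat finite by blast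
  then obtain i j where "i < j" and ij: "((*) s ^^ i) s = ((*) s ^^ j) s"
    using linorder_injI[of "\<lambda>n. ((*) s ^^ n) s"] by blast
  \<comment> \<open>The exponents here are i + 1 and j + 1, so s^(j+1) is the product of s^(i+1) and
    s^(k+1). Thus s^(i+1) absorbs s^(k+1) on the right, hence \<open>s\<close>, hence every power of
    \<open>s\<close>, including itself.\<close>
  then obtain k where "j = Suc (i + k)"
    by (auto dest: less_imp_Suc_add)
  then have "((*) s ^^ i) s * ((*) s ^^ k) s = ((*) s ^^ i) s"
    using ij funpow_mult_add[of i s k] by simp
  then have "((*) s ^^ i) s * ((*) s ^^ i) s = ((*) s ^^ i) s"
    by (simp only: R_trivial_stabilizer_power[OF assms])
  then show ?thesis ..
qed

lemma R_trivial_omega_power: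
  assumes "R_trivial TYPE('a::{finite, semigroup_mult})"
  shows "(s\<^sup>\<omega>) * (s\<^sup>\<omega>) = (s::'a)\<^sup>\<omega> \<and> (\<exists>n. s\<^sup>\<omega> = ((*) s ^^ n) s)"
  unfolding omega_power_def
proof (rule theI')
  \<comment> \<open>An idempotent power of \<open>s\<close> absorbs itself on the right, hence
    \<open>s\<close>, hence every other power. Since powers of \<open>s\<close> commute, x = xy = yx
    = y.\<close>
  have "x = y" if x: "x * x = x" "x = ((*) s ^^ m) s" and y: "y * y = y" "y = ((*) s ^^ n) s"
    for x y m n
  proof -
    have "x * s = x" "y * s = y"
      using x y R_trivial_stabilizer_power[OF assms] by metis+
    then have "x * y = x" "y * x = y"
      using x y R_trivial_stabilizer_power[OF assms] by metis+
    moreover have "x * y = y * x"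
      by (simp only: x(2) y(2) funpow_mult_add add.commute)
    ultimately show ?thesis
      by simp
  qed
  then show "\<exists>!x. x * x = x \<and> (\<exists>n. x = ((*) s ^^ n) s)"
    using R_trivial_ex_idempotent_power[OF assms, of s] by blast
qed

lemma R_trivial_stabilizer_omega:
  assumes "R_trivial TYPE('a::{finite, semigroup_mult})"
  shows "(x::'a) * s\<^sup>\<omega> = x \<longleftrightarrow> x * s = x"
proof -
  obtain n where "s\<^sup>\<omega> = ((*) s ^^ n) s"
    using R_trivial_omega_power[OF assms] by blast
  then show ?thesis
    by (simp only: R_trivial_stabilizer_power[OF assms])
qed

section \<open>The semilattice of left ideals and the maps c and d\<close>

lemma mem_range_mult_idempotent:
  fixes e :: "'a::semigroup_mult"
  assumes "e * e = e"
  shows "x \<in> range (\<lambda>y. y * e) \<longleftrightarrow> x * e = x"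
proof
  show "x \<in> range (\<lambda>y. y * e) \<Longrightarrow> x * e = x"
    using assms by (auto simp: mult.assoc)
qed (metis rangeI)

text \<open>The left ideal of an idempotent consists of the elements it fixes on the right, and
  \<open>s\<close> and its idempotent power fix the same elements. Inclusions and intersections in
  \<open>Lambda\<close> thereby become equations.\<close>

lemma mem_c_ideal:
  assumes "R_trivial TYPE('a::{finite, semigroup_mult})"
  shows "(x::'a) \<in> c_ideal s \<longleftrightarrow> x * s = x"
  using R_trivial_omega_power[OF assms, of s] R_trivial_stabilizer_omega[OF assms]
  by (simp add: c_ideal_def mem_range_mult_idempotent)

lemma c_ideal_in_Lambda:
  assumes "R_trivial TYPE('a::{finite, semigroup_mult})"
  shows "c_ideal (s::'a) \<in> Lambda"
  using R_trivial_omega_power[OF assms, of s] by (auto simp: c_ideal_def Lambda_def)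

lemma LambdaE:
  fixes X :: "'a::{finite, semigroup_mult} set"
  assumes "R_trivial TYPE('a)" "X \<in> Lambda"
  obtains e where "X = c_ideal e"
proof -
  obtain e :: 'a where "e * e = e" "X = range (\<lambda>x. x * e)"
    using assms(2) by (auto simp: Lambda_def)
  then have "X = c_ideal e"
    using mem_c_ideal[OF assms(1)] mem_range_mult_idempotent[of e] by blast
  then show ?thesis
    by (rule that)
qed

lemma Lambda_Int:
  fixes X Y :: "'a::{finite, semigroup_mult} set"
  assumes "R_trivial TYPE('a)" "X \<in> Lambda" "Y \<in> Lambda"
  shows "X \<inter> Y \<in> Lambda"
proof -
  obtain e f :: 'a where "X = c_ideal e" "Y = c_ideal f"
    using LambdaE assms by metis
  \<comment> \<open>An element is fixed by a product exactly when it is fixed by both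
    factors.\<close>
  then have "X \<inter> Y = c_ideal (e * f)"
    by (auto simp: mem_c_ideal[OF assms(1)] R_trivial_stabilizer_mult[OF assms(1)])
  then show ?thesis
    using c_ideal_in_Lambda[OF assms(1)] by simp
qed

text \<open>A solution of \<open>s * x = s\<close> puts \<open>s\<close> into some member of
  \<open>Lambda\<close>. Closure under finite intersections then makes the intersection of all
  members containing \<open>s\<close> the least one, so \<open>LEAST\<close> is meaningful.\<close>

lemma d_ideal_least:
  assumes "R_trivial TYPE('a::{finite, semigroup_mult})"
    and "(s::'a) \<in> range (\<lambda>x. s * x)"
  shows "d_ideal s \<in> Lambda" "s \<in> d_ideal s"
    and "\<And>X. X \<in> Lambda \<Longrightarrow> s \<in> X \<Longrightarrow> d_ideal s \<subseteq> X"
proof -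
  define F where "F = {X \<in> Lambda. s \<in> X}"
  obtain x where "s * x = s"
    using assms(2) by (metis imageE)
  then have "c_ideal x \<in> F"
    using mem_c_ideal[OF assms(1)] c_ideal_in_Lambda[OF assms(1)] by (simp add: F_def)
  then have "F \<noteq> {}"
    by blast
  have "\<Inter>A \<in> F" if "finite A" "A \<noteq> {}" "A \<subseteq> F" for A
    using that
    by (induction A rule: finite_ne_induct) (auto simp: F_def Lambda_Int[OF assms(1)])
  then have "\<Inter>F \<in> F"
    using \<open>F \<noteq> {}\<close> by simp
  then have "d_ideal s = \<Inter>F"
    unfolding d_ideal_def by (intro Least_equality) (auto simp: F_def)
  with \<open>\<Inter>F \<in> F\<close> show "d_ideal s \<in> Lambda" "s \<in> d_ideal s"
    and "\<And>X. X \<in> Lambda \<Longrightarrow> s \<in> X \<Longrightarrow> d_ideal s \<subseteq> X"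
    by (auto simp: F_def)
qed

lemma d_ideal_subset_c_ideal_iff:
  assumes "R_trivial TYPE('a::{finite, semigroup_mult})"
    and "(s::'a) \<in> range (\<lambda>x. s * x)"
  shows "d_ideal s \<subseteq> c_ideal t \<longleftrightarrow> s * t = s"
  using d_ideal_least[OF assms] c_ideal_in_Lambda[OF assms(1)] mem_c_ideal[OF assms(1)]
  by blast

section \<open>Coefficients and unitriangular families in the semigroup ring\<close>

lemma semigroup_ring_eqI: "(\<And>u. coeff a u = coeff b u) \<Longrightarrow> a = b"
  by (simp add: coeff_inject[symmetric] fun_eq_iff)

lemma coeff_sum: "coeff (sum f A) u = (\<Sum>x\<in>A. coeff (f x) u)"
  by (induction A rule: infinite_finite_induct)
    (simp_all add: zero_semigroup_ring.rep_eq plus_semigroup_ring.rep_eq)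

lemma coeff_sum_scale_elt:
  assumes "finite A"
  shows "coeff (\<Sum>t\<in>A. scale (n t) (elt t)) u = (if u \<in> A then n u else 0)"
  using assms by (simp add: coeff_sum scale.rep_eq elt.rep_eq if_distrib cong: if_cong)

lemma semigroup_ring_expansion:
  fixes a :: "'a::finite semigroup_ring"
  shows "a = (\<Sum>t\<in>UNIV. scale (coeff a t) (elt t))"
  by (rule semigroup_ring_eqI) (simp add: coeff_sum_scale_elt)

lemma coeff_elt_mult:
  fixes a :: "'a::{finite, semigroup_mult} semigroup_ring"
  shows "coeff (elt s * a) u = (\<Sum>t | s * t = u. coeff a t)"
proof (transfer fixing: s u)
  fix a :: "'a \<Rightarrow> int"
  have "(\<Sum>(x, t) | x * t = u. (if x = s then 1 else 0) * a t) =
      (\<Sum>(x, t) \<in> Pair s ` {t. s * t = u}. (if x = s then 1 else 0) * a t)"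
    by (rule sum.mono_neutral_right) auto
  also have "\<dots> = (\<Sum>t | s * t = u. a t)"
    by (subst sum.reindex) (auto simp: inj_on_def)
  finally show "(\<Sum>(x, t) | x * t = u. (if x = s then 1 else 0) * a t) = (\<Sum>t | s * t = u. a t)" .
qed

text \<open>Diagonal entries 1 allow triangular elimination over the integers without division. By
  finiteness both \<open>r\<close> and its converse are well-founded: the converse drives
  independence, \<open>r\<close> itself drives spanning.\<close>

lemma is_basis_unitriangular:
  fixes b :: "'a::finite \<Rightarrow> 'a semigroup_ring" and r :: "'a \<Rightarrow> 'a \<Rightarrow> bool"
  assumes asymp: "asymp r" and transp: "transp r"
    and diag: "\<And>s. coeff (b s) s = 1"
    and tri: "\<And>s t. coeff (b s) t \<noteq> 0 \<Longrightarrow> t = s \<or> r t s"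
  shows "is_basis b"
proof -
  have wf: "wfp r" "wfp r\<inverse>\<inverse>"
    using asymp transp by (simp_all add: strict_partial_order_wfp_on_finite_set)
  \<comment> \<open>Induction descends from the \<open>r\<close>-maximal elements. At the
    coefficient of \<open>s\<close>, any other contributing \<open>t\<close> satisfies
    \<open>r s t\<close>, so \<open>k t\<close> is already known to vanish.\<close>
  have zero: "k s = 0" if "(\<Sum>s\<in>UNIV. scale (k s) (b s)) = 0" for k :: "'a \<Rightarrow> int" and s
    using wf(2)
  proof (induction s rule: wfp_induct_rule)
    case (less s)
    have "0 = (\<Sum>t\<in>UNIV. k t * coeff (b t) s)"
      using arg_cong[OF that, of "\<lambda>a. coeff a s"]
      by (simp add: coeff_sum scale.rep_eq zero_semigroup_ring.rep_eq)
    also have "\<dots> = (\<Sum>t\<in>{s}. k t * coeff (b t) s)"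
      using less tri by (intro sum.mono_neutral_right) auto
    finally show ?case
      by (simp add: diag)
  qed
  have inj: "inj b"
  proof (rule injI)
    fix s t
    assume "b s = b t"
    then have "t = s \<or> r t s" "s = t \<or> r s t"
      using diag tri by (metis zero_neq_one)+
    then show "s = t"
      using asymp by (auto dest: asympD)
  qed
  have "ZS.independent (range b)"
  proof
    assume "ZS.dependent (range b)"
    then obtain u s where "(\<Sum>v\<in>range b. scale (u v) v) = 0" "u (b s) \<noteq> 0"
      by (auto simp: ZS.dependent_finite)
    then show False
      using zero[of "u \<circ> b" s] by (simp add: sum.reindex[OF inj])
  qed
  moreover have elt: "elt s \<in> ZS.span (range b)" for s
    using wf(1)
  proof (induction s rule: wfp_induct_rule)
    case (less s)
    \<comment> \<open>The equation for \<open>b s\<close> is solved for its leading term; the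
      subtracted elements are \<open>r\<close>-below \<open>s\<close> and lie in the span by
      induction.\<close>
    have "elt s = b s - (\<Sum>t | r t s. scale (coeff (b s) t) (elt t))"
    proof (rule semigroup_ring_eqI)
      fix u
      show "coeff (elt s) u = coeff (b s - (\<Sum>t | r t s. scale (coeff (b s) t) (elt t))) u"
        using diag[of s] tri[of s u] asympD[OF asymp]
        by (auto simp: minus_semigroup_ring.rep_eq coeff_sum_scale_elt elt.rep_eq)
    qed
    also have "\<dots> \<in> ZS.span (range b)"
      using less by (auto intro!: ZS.span_diff ZS.span_sum ZS.span_scale intro: ZS.span_base)
    finally show ?case .
  qed
  have "a \<in> ZS.span (range b)" for a
    by (subst semigroup_ring_expansion) (intro ZS.span_sum ZS.span_scale elt)
  ultimately show ?thesis
    using inj by (auto simp: is_basis_def)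
qed

section \<open>The products of \<open>s\<close> with the idempotent at d(s)\<close>

lemma coeff_elt_mult_d_ideal:
  assumes "R_trivial TYPE('a::{finite, semigroup_mult})"
    and "(s::'a) \<in> range (\<lambda>x. s * x)"
    and "tau a (d_ideal s) = 1"
  shows "coeff (elt s * a) s = 1"
proof -
  have "coeff (elt s * a) s = (\<Sum>t\<in>UNIV. coeff a t * of_bool (s * t = s))"
    by (simp add: coeff_elt_mult of_bool_def if_distrib sum.If_cases cong: if_cong)
  \<comment> \<open>The condition \<open>s * t = s\<close> says that d(s) is contained in c(t),
    which is what the indicator in \<open>tau\<close> tests at d(s).\<close>
  also have "\<dots> = tau a (d_ideal s)"
    unfolding tau_def using d_ideal_least[OF assms(1,2)] d_ideal_subset_c_ideal_iff[OF assms(1,2)]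
    by (intro sum.cong) (auto simp: indicator_def)
  finally show ?thesis
    using assms(3) by simp
qed

lemma coeff_elt_mult_nonzero:
  fixes a :: "'a::{finite, semigroup_mult} semigroup_ring"
  assumes "coeff (elt s * a) t \<noteq> 0"
  shows "t \<le>\<^sub>R s"
proof -
  obtain x where "s * x = t"
    using assms by (force simp: coeff_elt_mult dest: sum.not_neutral_contains_not_neutral)
  then show ?thesis
    using R_le_mult by blast
qed

theorem corollary3p6:
  fixes e :: "'a::{finite, semigroup_mult} set \<Rightarrow> 'a semigroup_ring"
  assumes "R_trivial TYPE('a)"
    and "connected_semigroup TYPE('a)"
    and "\<And>X. X \<in> Lambda \<Longrightarrow> e X * e X = e X"
    and "\<And>X Y. X \<in> Lambda \<Longrightarrow> Y \<in> Lambda \<Longrightarrow> X \<noteq> Y \<Longrightarrow> e X * e Y = 0"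
    and "\<And>X. X \<in> Lambda \<Longrightarrow> tau (e X) = delta X"
    and "is_identity (\<Sum>X\<in>Lambda. e X)"
  shows "(\<forall>s::'a. \<exists>n::'a \<Rightarrow> int.
            elt s * e (d_ideal s) = elt s + (\<Sum>t | t <\<^sub>R s. scale (n t) (elt t)))
         \<and> is_basis (\<lambda>s::'a. elt s * e (d_ideal s))"
proof -
  have mem: "s \<in> range (\<lambda>x. s * x)" for s :: 'a
    using assms(2) unfolding connected_semigroup_def by blast
  have diag: "coeff (elt s * e (d_ideal s)) s = 1" for s
    using coeff_elt_mult_d_ideal[OF assms(1) mem] assms(5) d_ideal_least(1)[OF assms(1) mem]
    by (simp add: delta_def)
  have tri: "t = s \<or> t <\<^sub>R s" if "coeff (elt s * e (d_ideal s)) t \<noteq> 0" for s t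
    using coeff_elt_mult_nonzero[OF that] by (auto simp: R_less_def)
  have "asymp ((<\<^sub>R) :: 'a \<Rightarrow> 'a \<Rightarrow> bool)"
    by (rule asympI) (use R_trivial_antisym[OF assms(1)] in \<open>auto simp: R_less_def\<close>)
  moreover have "transp ((<\<^sub>R) :: 'a \<Rightarrow> 'a \<Rightarrow> bool)"
    unfolding R_less_def
    by (rule transpI) (metis R_le_trans R_trivial_antisym[OF assms(1)])
  ultimately have "is_basis (\<lambda>s. elt s * e (d_ideal s))"
    using diag tri by (rule is_basis_unitriangular)
  \<comment> \<open>The integers n_t are the coefficients of the product itself; the sum omits
    \<open>s\<close>, whose coefficient 1 accounts for the separate term
    \<open>elt s\<close>.\<close>
  moreover have "elt s * e (d_ideal s) = elt s + (\<Sum>t | t <\<^sub>R s.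
      scale (coeff (elt s * e (d_ideal s)) t) (elt t))" for s
  proof (rule semigroup_ring_eqI)
    fix u
    show "coeff (elt s * e (d_ideal s)) u = coeff (elt s + (\<Sum>t | t <\<^sub>R s.
        scale (coeff (elt s * e (d_ideal s)) t) (elt t))) u"
      using diag[of s] tri[of s u]
      by (auto simp: plus_semigroup_ring.rep_eq coeff_sum_scale_elt elt.rep_eq R_less_def)
  qed
  ultimately show ?thesis
    by blast
qed

end
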